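(* Let $F$ be a field of characteristic different from $2$ and let $L$ be a symplectic alternating algebra over $F$ such that the product $\cdot$ of $L$ is associative or $(L,\cdot)$ is a Lie algebra. Then $L^{3}=\{0\}$.
   Context: A symplectic alternating algebra over a field $F$ is a triple $(L,(\ ,\ ),\cdot)$ where $L$ is a finite-dimensional vector space over $F$ with a non-degenerate alternating bilinear form $(\ ,\ )$ and $\cdot$ is a bilinear alternating operation on $L$ (so $u\cdot u=0$ for all $u$) such that $(u\cdot v,w)=(v\cdot w,u)$ for all $u,v,w\in L$. For subspaces $U,V$ of $L$, $UV$ denotes the subspace spanned by all products $u\cdot v$ with $u\in U$, $v\in V$. The lower central series is $L^{1}=L$, $L^{k+1}=L^{k}L$. *)

theory Defs
  imports Complex_Main
begin

definition bilinear_map ::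
    "('a::field \<Rightarrow> 'b::ab_group_add \<Rightarrow> 'b) \<Rightarrow> ('a \<Rightarrow> 'c::ab_group_add \<Rightarrow> 'c) \<Rightarrow> ('b \<Rightarrow> 'b \<Rightarrow> 'c) \<Rightarrow> bool"
  where "bilinear_map s t f \<longleftrightarrow>
    (\<forall>v. Vector_Spaces.linear s t (\<lambda>u. f u v)) \<and> (\<forall>u. Vector_Spaces.linear s t (\<lambda>v. f u v))"

text \<open>The algebra is the whole type \<^typ>\<open>'b\<close>, a vector space over the field \<^typ>\<open>'a\<close> via \<open>scale\<close>.\<close>

locale symplectic_alternating_algebra = vector_space scale
  for scale :: "'a::field \<Rightarrow> 'b::ab_group_add \<Rightarrow> 'b" +
  fixes form :: "'b \<Rightarrow> 'b \<Rightarrow> 'a"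
    and alg_mult :: "'b \<Rightarrow> 'b \<Rightarrow> 'b"
  assumes finite_dimensional: "\<exists>B. finite_dimensional_vector_space scale B"
    and form_bilinear: "bilinear_map scale (*) form"
    and form_alternating: "form u u = 0"
    and form_nondegenerate: "(\<forall>v. form u v = 0) \<Longrightarrow> u = 0"
    and mult_bilinear: "bilinear_map scale scale alg_mult"
    and mult_alternating: "alg_mult u u = 0"
    and form_mult_cyclic: "form (alg_mult u v) w = form (alg_mult v w) u"

locale lie_algebra = vector_space scale
  for scale :: "'a::field \<Rightarrow> 'b::ab_group_add \<Rightarrow> 'b" +
  fixes bracket :: "'b \<Rightarrow> 'b \<Rightarrow> 'b"
  assumes bracket_bilinear: "bilinear_map scale scale bracket"
    and bracket_alternating: "bracket u u = 0"
    and jacobi: "bracket (bracket u v) w + bracket (bracket v w) u + bracket (bracket w u) v = 0"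

definition subspace_product ::
    "('a::field \<Rightarrow> 'b::ab_group_add \<Rightarrow> 'b) \<Rightarrow> ('b \<Rightarrow> 'b \<Rightarrow> 'b) \<Rightarrow> 'b set \<Rightarrow> 'b set \<Rightarrow> 'b set"
  where "subspace_product scale alg_mult U V =
    module.span scale {alg_mult u v | u v. u \<in> U \<and> v \<in> V}"

text \<open>The series starts at index 1; the value at index 0 is a convention.\<close>

fun lower_central_series ::
    "('a::field \<Rightarrow> 'b::ab_group_add \<Rightarrow> 'b) \<Rightarrow> ('b \<Rightarrow> 'b \<Rightarrow> 'b) \<Rightarrow> nat \<Rightarrow> 'b set"
  where
    "lower_central_series scale alg_mult 0 = UNIV"
  | "lower_central_series scale alg_mult (Suc 0) = UNIV"
  | "lower_central_series scale alg_mult (Suc (Suc k)) =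
      subspace_product scale alg_mult (lower_central_series scale alg_mult (Suc k)) UNIV"

end

(* Cyclicity makes every right multiplication R_v self-adjoint for the form, (u v, w) = (u, w v).
   If the product is associative, R_{vw} is R_v followed by R_w, and its adjoint R_w followed by R_v
   is R_{wv} = - R_{vw}. If it satisfies the Jacobi identity, R_{vw} is the commutator of R_v and
   R_w, whose adjoint is its negative. So in both cases R_{vw} is at once self-adjoint and
   skew-adjoint, hence zero in characteristic different from 2. *)
theory Submission
  imports Defs
begin

lemma two_neq_zero_if_CHAR_neq_2:
  assumes "CHAR('a::field) \<noteq> 2"
  shows "(2::'a) \<noteq> 0"
proof
  assume "(2::'a) = 0"
  then have "CHAR('a) dvd 2"
    by (metis of_nat_eq_0_iff_char_dvd of_nat_numeral)
  then have "CHAR('a) \<le> 2"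
    by (rule dvd_imp_le) simp
  moreover have "CHAR('a) \<noteq> 0"
    using \<open>CHAR('a) dvd 2\<close> by (metis dvd_0_left_iff zero_neq_numeral)
  \<comment> \<open>In a field \<open>1\<close> differs from \<open>0\<close>, so of the divisors of
    2 only 2 itself remains.\<close>
  moreover have "CHAR('a) \<noteq> Suc 0"
    by simp
  ultimately show False
    using assms by linarith
qed

context symplectic_alternating_algebra
begin

lemma module_hom_mult_left: "module_hom scale scale (\<lambda>u. alg_mult u v)"
  and module_hom_mult_right: "module_hom scale scale (alg_mult u)"
  and module_hom_form_left: "module_hom scale (*) (\<lambda>u. form u v)"
  and module_hom_form_right: "module_hom scale (*) (form u)"
  using mult_bilinear form_bilinear
  unfolding bilinear_map_def linear_iff_module_hom by blast+

lemmas mult_add_left = module_hom.add [OF module_hom_mult_left]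
  and mult_add_right = module_hom.add [OF module_hom_mult_right]
  and mult_minus_left = module_hom.neg [OF module_hom_mult_left]
  and mult_minus_right = module_hom.neg [OF module_hom_mult_right]
  and form_add_left = module_hom.add [OF module_hom_form_left]
  and form_add_right = module_hom.add [OF module_hom_form_right]
  and form_minus_right = module_hom.neg [OF module_hom_form_right]
  and form_diff_left = module_hom.diff [OF module_hom_form_left]
  and form_diff_right = module_hom.diff [OF module_hom_form_right]

text \<open>Polarisation: the square of \<open>v + u\<close> vanishes, and so do the two pure
  squares in its expansion.\<close>

lemma mult_skew: "alg_mult v u = - alg_mult u v"
proof -
  have "alg_mult v u + alg_mult u v = (alg_mult v v + alg_mult v u) + (alg_mult u v + alg_mult u u)"
    by (simp only: mult_alternating add_0_left add_0_right)
  also have "\<dots> = alg_mult (v + u) (v + u)"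
    by (simp only: mult_add_left mult_add_right ac_simps)
  also have "\<dots> = 0"
    by (rule mult_alternating)
  finally show ?thesis
    by (rule eq_neg_iff_add_eq_0 [THEN iffD2])
qed

lemma form_skew: "form v u = - form u v"
proof -
  have "form v u + form u v = (form v v + form v u) + (form u v + form u u)"
    by (simp only: form_alternating add_0_left add_0_right)
  also have "\<dots> = form (v + u) (v + u)"
    by (simp only: form_add_left form_add_right ac_simps)
  also have "\<dots> = 0"
    by (rule form_alternating)
  finally show ?thesis
    by (rule eq_neg_iff_add_eq_0 [THEN iffD2])
qed

text \<open>Cyclicity brings \<open>u\<close> to the second slot of the form; the sign from swapping
  the slots cancels the sign from swapping the factors of the product.\<close>

lemma right_mult_self_adjoint: "form (alg_mult u v) w = form u (alg_mult w v)"
proof -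
  have "form (alg_mult u v) w = form (alg_mult v w) u"
    by (rule form_mult_cyclic)
  also have "\<dots> = - form u (alg_mult v w)"
    by (rule form_skew)
  also have "\<dots> = form u (alg_mult w v)"
    by (simp only: mult_skew [of w v] form_minus_right)
  finally show ?thesis .
qed

lemma mult_eq_0_if_skew_adjoint:
  assumes "CHAR('a) \<noteq> 2"
    and skew: "\<And>x. form (alg_mult u a) x = - form u (alg_mult x a)"
  shows "alg_mult u a = 0"
proof (rule form_nondegenerate, rule allI)
  fix x
  have "form (alg_mult u a) x + form (alg_mult u a) x = 0"
    \<comment> \<open>Only the second summand is rewritten by self-adjointness; \<open>skew\<close>
      turns the first into its negative.\<close>
    by (subst (2) right_mult_self_adjoint) (simp only: skew add.left_inverse)
  then have "2 * form (alg_mult u a) x = 0"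
    by (simp only: mult_2)
  then show "form (alg_mult u a) x = 0"
    using two_neq_zero_if_CHAR_neq_2 [OF assms(1)] by simp
qed

lemma mult_mult_eq_0_associative:
  assumes "CHAR('a) \<noteq> 2" and "semigroup alg_mult"
  shows "alg_mult u (alg_mult v w) = 0"
proof (rule mult_eq_0_if_skew_adjoint [OF assms(1)])
  fix x
  have assoc: "alg_mult a (alg_mult b c) = alg_mult (alg_mult a b) c" for a b c
    using semigroup.assoc [OF assms(2)] by simp
  \<comment> \<open>Since \<open>u(vw) = (uv)w\<close>, first \<open>w\<close> and then
    \<open>v\<close> moves across the form, so they act on \<open>x\<close> in reversed
    order.\<close>
  have "form (alg_mult u (alg_mult v w)) x = form u (alg_mult (alg_mult x w) v)"
    by (simp only: assoc right_mult_self_adjoint)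
  also have "\<dots> = form u (alg_mult x (alg_mult w v))"
    by (simp only: assoc)
  also have "\<dots> = - form u (alg_mult x (alg_mult v w))"
    by (simp only: mult_skew [of w v] mult_minus_right form_minus_right)
  finally show "form (alg_mult u (alg_mult v w)) x = - form u (alg_mult x (alg_mult v w))" .
qed

lemma mult_mult_eq_0_lie:
  assumes "CHAR('a) \<noteq> 2" and "lie_algebra scale alg_mult"
  shows "alg_mult u (alg_mult v w) = 0"
proof (rule mult_eq_0_if_skew_adjoint [OF assms(1)])
  fix x
  \<comment> \<open>This is the Jacobi identity for \<open>a\<close>, \<open>v\<close>,
    \<open>w\<close>, with \<open>(vw)a\<close> and \<open>(wa)v\<close> replaced by
    \<open>-a(vw)\<close> and \<open>-(aw)v\<close>.\<close>
  have commutator: "alg_mult a (alg_mult v w)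
      = alg_mult (alg_mult a v) w - alg_mult (alg_mult a w) v" for a
  proof -
    have "alg_mult (alg_mult a v) w - alg_mult a (alg_mult v w) - alg_mult (alg_mult a w) v = 0"
      using lie_algebra.jacobi [OF assms(2), of a v w]
      by (simp only: mult_skew [of "alg_mult v w" a] mult_skew [of w a] mult_minus_left
          add_uminus_conv_diff)
    then show ?thesis
      by (simp add: algebra_simps)
  qed
  show "form (alg_mult u (alg_mult v w)) x = - form u (alg_mult x (alg_mult v w))"
    \<comment> \<open>Taking adjoints exchanges the two terms of the commutator, which changes its
      sign.\<close>
    by (simp add: commutator form_diff_left form_diff_right right_mult_self_adjoint)
qed

lemma lower_central_series_3_eq_0:
  assumes "\<And>u v w. alg_mult u (alg_mult v w) = 0"
  shows "lower_central_series scale alg_mult 3 = {0}"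
proof -
  define P where "P = {alg_mult u v | u v. u \<in> UNIV \<and> v \<in> UNIV}"
  \<comment> \<open>Left multiplication by \<open>w\<close> is linear, so its kernel is a subspace,
    and it suffices that it contains the generators of \<open>span P\<close>, which is the second
    term of the series.\<close>
  have "span P \<subseteq> {a. alg_mult w a = 0}" for w
  proof (rule span_minimal)
    show "P \<subseteq> {a. alg_mult w a = 0}"
      using assms by (auto simp: P_def)
    show "subspace {a. alg_mult w a = 0}"
      by (rule module_hom.subspace_kernel [OF module_hom_mult_right])
  qed
  then have "alg_mult w a = 0" if "a \<in> span P" for a w
    using that by blast
  \<comment> \<open>The series multiplies by the whole algebra on the right, whereas the assumption
    has the inner product as right factor; skew-symmetry exchanges the sides.\<close>
  then have "alg_mult a w = 0" if "a \<in> span P" for a w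
    using that by (simp only: mult_skew [of a w] minus_zero)
  then have "{alg_mult a w | a w. a \<in> span P \<and> w \<in> UNIV} \<subseteq> {0}"
    by auto
  then have "span {alg_mult a w | a w. a \<in> span P \<and> w \<in> UNIV} = {0}"
    by (rule span_subspace) (simp_all add: span_zero subspace_single_0)
  then show ?thesis
    by (simp add: numeral_3_eq_3 subspace_product_def P_def)
qed

end

theorem lemma1p1:
  fixes scale :: "'a::field \<Rightarrow> 'b::ab_group_add \<Rightarrow> 'b"
    and form :: "'b \<Rightarrow> 'b \<Rightarrow> 'a"
    and alg_mult :: "'b \<Rightarrow> 'b \<Rightarrow> 'b"
  assumes "CHAR('a) \<noteq> 2"
    and "symplectic_alternating_algebra scale form alg_mult"
    and "semigroup alg_mult \<or> lie_algebra scale alg_mult"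
  shows "lower_central_series scale alg_mult 3 = {0}"
proof -
  interpret symplectic_alternating_algebra scale form alg_mult
    by (fact assms(2))
  show ?thesis
    using assms(1,3) mult_mult_eq_0_associative mult_mult_eq_0_lie
    by (intro lower_central_series_3_eq_0) blast
qed

end
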